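(* Let $\pi\in\mathcal S_n$ be a permutation, and let $D(\pi)$ be its diagram. Then the number of occurrences of the pattern $132$ in $\pi$ is equal to $$\sum_{(i,j)\in D(\pi)}\rho((i,j)).$$
   Context: $\mathcal S_n$ is the symmetric group on $\{1,\dots,n\}$, with permutations written as words $\pi=\pi_1\cdots\pi_n$. An occurrence of the pattern $132$ in $\pi$ is a triple of indices $i<j<k$ with $\pi_i<\pi_k<\pi_j$. Diagram: represent $\pi$ by an $n\times n$ array of squares (rows numbered top to bottom, columns left to right) with a dot in each square $(i,\pi_i)$. Shade each dotted square and all squares due south or due east of some dot. $D(\pi)$ is the set of unshaded squares, i.e. $D(\pi)=\{(i,j): j<\pi_i,\ \pi^{-1}(j)>i\}$. The rank $\rho((i,j))$ of a square $(i,j)\in D(\pi)$ is the number of dots northwest of $(i,j)$, i.e. the number of indices $m<i$ with $\pi_m<j$. *)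

theory Defs
  imports "HOL-Combinatorics.Permutations"
begin

text \<open>
  A permutation in \<open>S\<^sub>n\<close> is a function \<open>\<pi>\<close> with \<open>\<pi> permutes {1..n}\<close>; its word is
  \<open>\<pi> 1, \<dots>, \<pi> n\<close>. Such a \<open>\<pi>\<close> is the identity outside \<open>{1..n}\<close> (in particular \<open>\<pi> 0 = 0\<close>),
  so all indices below are explicitly restricted to \<open>{1..n}\<close>.
\<close>

definition occurrences_132 :: "nat \<Rightarrow> (nat \<Rightarrow> nat) \<Rightarrow> (nat \<times> nat \<times> nat) set" where
  "occurrences_132 n \<pi> =
     {(i, j, k). i \<in> {1..n} \<and> j \<in> {1..n} \<and> k \<in> {1..n} \<and>
                 i < j \<and> j < k \<and> \<pi> i < \<pi> k \<and> \<pi> k < \<pi> j}"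

text \<open>
  Square \<open>(i, j)\<close> lies in row \<open>i\<close> (counted from the top) and column \<open>j\<close> (counted from the left).
  The first disjunct is ``on or due east of a dot'', the second ``on or due south of a dot''.
\<close>

definition shaded :: "nat \<Rightarrow> (nat \<Rightarrow> nat) \<Rightarrow> nat \<times> nat \<Rightarrow> bool" where
  "shaded n \<pi> = (\<lambda>(i, j). \<exists>m \<in> {1..n}. (i = m \<and> \<pi> m \<le> j) \<or> (j = \<pi> m \<and> m \<le> i))"

definition diagram :: "nat \<Rightarrow> (nat \<Rightarrow> nat) \<Rightarrow> (nat \<times> nat) set" where
  "diagram n \<pi> = {s \<in> {1..n} \<times> {1..n}. \<not> shaded n \<pi> s}"

definition diagram_rank :: "nat \<Rightarrow> (nat \<Rightarrow> nat) \<Rightarrow> nat \<times> nat \<Rightarrow> nat" where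
  "diagram_rank n \<pi> = (\<lambda>(i, j). card {m \<in> {1..n}. m < i \<and> \<pi> m < j})"

lemma diagram_eq:
  assumes "\<pi> permutes {1..n}"
  shows "diagram n \<pi> = {(i, j). i \<in> {1..n} \<and> j \<in> {1..n} \<and> j < \<pi> i \<and> inv \<pi> j > i}"
proof -
  have "shaded n \<pi> (i, j) \<longleftrightarrow> \<pi> i \<le> j \<or> inv \<pi> j \<le> i"
    if "i \<in> {1..n}" "j \<in> {1..n}" for i j
  proof -
    have mem: "inv \<pi> j \<in> {1..n}"
      using permutes_in_image[OF permutes_inv[OF assms]] that(2) by blast
    have eq: "j = \<pi> m \<longleftrightarrow> m = inv \<pi> j" for m
      using permutes_inverses[OF assms] by auto
    show ?thesis
      unfolding shaded_def prod.case eq using mem that(1) by blast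
  qed
  then show ?thesis
    unfolding diagram_def by (force simp: not_le)
qed

end

theory Submission
  imports Defs
begin

text \<open>
  An inversion \<open>j < k\<close>, \<open>\<pi> k < \<pi> j\<close> corresponds to the diagram square \<open>(j, \<pi> k)\<close>: the dot of
  row \<open>j\<close> lies to its right and the dot of column \<open>\<pi> k\<close> lies below it. An index \<open>i\<close> completes
  the inversion to an occurrence \<open>(i, j, k)\<close> of 132 exactly when \<open>i < j\<close> and \<open>\<pi> i < \<pi> k\<close>, that
  is, when the dot of row \<open>i\<close> lies northwest of that square. So the occurrences whose last two
  letters are a given inversion are counted by the rank of its square.
\<close>

lemma bij_betw_occurrences_132_northwest_dots:
  assumes "\<pi> permutes {1..n}"
  shows "bij_betw (\<lambda>(i, j, k). ((j, \<pi> k), i)) (occurrences_132 n \<pi>)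
           (SIGMA s:diagram n \<pi>. {m \<in> {1..n}. m < fst s \<and> \<pi> m < snd s})"
    (is "bij_betw ?f ?O ?S")
proof (rule bij_betw_byWitness[where f' = "\<lambda>((j, c), i). (i, j, inv \<pi> c)"])
  have range: "\<pi> x \<in> {1..n} \<longleftrightarrow> x \<in> {1..n}" "inv \<pi> x \<in> {1..n} \<longleftrightarrow> x \<in> {1..n}" for x
    using permutes_in_image[OF assms] permutes_in_image[OF permutes_inv[OF assms]] by auto
  note inverses = permutes_inverses[OF assms]
  show "\<forall>t\<in>?O. (\<lambda>((j, c), i). (i, j, inv \<pi> c)) (?f t) = t"
    using inverses by auto
  show "\<forall>t\<in>?S. ?f ((\<lambda>((j, c), i). (i, j, inv \<pi> c)) t) = t"
    using inverses by auto
  show "?f ` ?O \<subseteq> ?S"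
    using range inverses unfolding occurrences_132_def diagram_eq[OF assms] by fastforce
  show "(\<lambda>((j, c), i). (i, j, inv \<pi> c)) ` ?S \<subseteq> ?O"
    using range inverses unfolding occurrences_132_def diagram_eq[OF assms] by fastforce
qed

theorem theorem5p1:
  fixes n :: nat and \<pi> :: "nat \<Rightarrow> nat"
  assumes "\<pi> permutes {1..n}"
  shows "card (occurrences_132 n \<pi>) = (\<Sum>s \<in> diagram n \<pi>. diagram_rank n \<pi> s)"
proof -
  have "finite (diagram n \<pi>)"
    unfolding diagram_def by simp
  then show ?thesis
    using bij_betw_same_card[OF bij_betw_occurrences_132_northwest_dots[OF assms]]
    by (simp add: diagram_rank_def case_prod_beta)
qed

end
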